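(* Let $\mathbb{F}\in\{\mathbb{R},\mathbb{C}\}$, let $\mathcal{N}$ be a separable Hilbert space over $\mathbb{F}$, and let $\{\varphi_n\mid n\in\mathbb{N}\}\subseteq\mathcal{N}\setminus\{0\}$ be a countable set which is dense in $\mathcal{N}$. Define $$C_{nm}=\|\varphi_n\|^{-1}\|\varphi_m\|^{-1}\langle\varphi_n|\varphi_m\rangle,\qquad n,m\in\mathbb{N}.$$ Then the matrix $C=(C_{nm})_{n,m\in\mathbb{N}}$ is an extreme point of the convex set $\mathcal{C}$ of $\mathbb{F}$-valued correlation matrices indexed by $\mathbb{N}$, and $\mathrm{rank}\,C=\dim\mathcal{N}$.
   Context: $\mathbb{N}=\{1,2,3,\dots\}$. $\mathcal{C}$ denotes the set of correlation matrices: infinite matrices $C=(C_{nm})_{n,m\in\mathbb{N}}$ with entries in $\mathbb{F}$ that are Hermitian ($C_{mn}=\overline{C_{nm}}$; symmetric if $\mathbb{F}=\mathbb{R}$), have unit diagonal ($C_{nn}=1$ for all $n$), and are positive semidefinite, meaning $\sum_{n,m}\overline{c_n}C_{nm}c_m\ge 0$ for every $\mathbb{F}$-valued sequence $(c_n)_{n\in\mathbb{N}}$ with only finitely many nonzero terms. $\mathcal{C}$ is a convex subset of the real vector space of Hermitian $\mathbb{F}$-valued matrices indexed by $\mathbb{N}$ (entrywise operations). Inner products are linear in the second argument. $\ell^1(\mathbb{N})$ is the Banach space over $\mathbb{F}$ of absolutely summable $\mathbb{F}$-valued sequences, and $\ell^1(\mathbb{N})^\times$ is its topological antidual, i.e.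 the $\mathbb{F}$-linear space of continuous antilinear functionals $\ell^1(\mathbb{N})\to\mathbb{F}$. Every $C\in\mathcal{C}$ satisfies $|C_{nm}|\le 1$ and so defines a continuous linear map $\tilde C:\ell^1(\mathbb{N})\to\ell^1(\mathbb{N})^\times$ by $[\tilde C(c)](d)=\sum_{n,m\in\mathbb{N}}\overline{d_n}C_{nm}c_m$. The rank of $C$ is $\mathrm{rank}\,C=\dim\tilde C(\ell^1(\mathbb{N}))\in\mathbb{N}\cup\{\infty\}$. All dimensions are understood as elements of $\mathbb{N}\cup\{\infty\}$, i.e. every infinite-dimensional space has dimension $\infty$ (no distinction among infinite cardinals). *)

theory Defs
  imports
    "HOL-Analysis.Analysis"
    "HOL-Library.Function_Algebras"
    "HOL-Library.Extended_Nat"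
begin

section \<open>The scalar field: real or complex numbers\<close>

text \<open>
  A type of this class is a copy of the real or of the complex numbers, with its usual absolute
  value and conjugation; see the two instances and the classification \<open>rc_field_cases\<close> below.
\<close>

class rc_field = real_normed_field + banach +
  fixes conjg :: "'a \<Rightarrow> 'a"
  assumes conjg_add: "conjg (x + y) = conjg x + conjg y"
    and conjg_mult: "conjg (x * y) = conjg x * conjg y"
    and conjg_conjg [simp]: "conjg (conjg x) = x"
    and mult_conjg_scaleR: "x * conjg x = (norm x)\<^sup>2 *\<^sub>R 1"

lemma mult_conjg: "x * conjg x = of_real ((norm (x::'f::rc_field))\<^sup>2)"
  by (simp add: mult_conjg_scaleR of_real_def)

instantiation real :: rc_field
begin

definition conjg_real :: "real \<Rightarrow> real" where [simp]: "conjg_real x = x"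

instance by standard (auto simp: power2_eq_square)

end

instantiation complex :: rc_field
begin

definition conjg_complex :: "complex \<Rightarrow> complex" where [simp]: "conjg_complex = cnj"

instance
proof
  fix x :: complex
  show "x * conjg x = (norm x)\<^sup>2 *\<^sub>R 1"
    by (simp add: complex_mult_cnj cmod_power2 scaleR_conv_of_real)
qed auto

end

lemma conjg_zero [simp]: "conjg (0::'f::rc_field) = 0"
  using conjg_add[of "0::'f" 0] by simp

lemma conjg_minus: "conjg (- x) = - conjg (x::'f::rc_field)"
  using conjg_add[of x "- x"] by (simp add: eq_neg_iff_add_eq_0 add.commute)

lemma conjg_diff: "conjg (x - y) = conjg x - conjg (y::'f::rc_field)"
  using conjg_add[of x "- y"] by (simp add: conjg_minus)

lemma conjg_of_real [simp]: "conjg (of_real r :: 'f::rc_field) = of_real r"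
proof (cases "r = 0")
  case False
  have "(of_real r :: 'f) * conjg (of_real r) = of_real r * of_real r"
    by (simp add: mult_conjg power2_eq_square)
  then show ?thesis using False by simp
qed simp

lemma conjg_one [simp]: "conjg (1::'f::rc_field) = 1"
  using conjg_of_real[of 1] by simp

lemma norm_conjg [simp]: "norm (conjg x) = norm (x::'f::rc_field)"
proof (cases "x = 0")
  case False
  have "norm x * norm (conjg x) = norm x * norm x"
    by (metis abs_of_nonneg mult_conjg norm_ge_zero norm_mult norm_of_real power2_eq_square
        zero_le_power2)
  then show ?thesis using False by simp
qed simp

lemma conjg_sum: "conjg (sum f A) = (\<Sum>x\<in>A. conjg (f x :: 'f::rc_field))"
  by (induction A rule: infinite_finite_induct) (auto simp: conjg_add)

lemma conjg_eq_imp_of_real: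
  fixes x :: "'f::rc_field"
  assumes "conjg x = x"
  obtains r where "x = of_real r"
proof -
  have "x * x = of_real (norm x) * of_real (norm x)"
    using mult_conjg[of x] assms by (simp add: power2_eq_square)
  then have "x = of_real (norm x) \<or> x = of_real (- norm x)"
    by (simp add: square_eq_iff)
  then show ?thesis using that by blast
qed

lemma rc_field_cases:
  fixes dummy :: "'f::rc_field itself"
  obtains
    (real) "\<And>x::'f. \<exists>!a. x = of_real a"
  | (complex) \<i>' :: 'f where "\<i>' * \<i>' = - 1"
      "\<And>x::'f. \<exists>!(a, b). x = of_real a + of_real b * \<i>'"
      "\<And>a b. conjg (of_real a + of_real b * \<i>') = of_real a - of_real b * \<i>'"
      "\<And>a b. norm (of_real a + of_real b * \<i>') = norm (Complex a b)"
proof (cases "\<forall>x::'f. conjg x = x")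
  case True
  then have "\<exists>a. x = of_real a" for x :: 'f
    by (meson conjg_eq_imp_of_real)
  then show ?thesis by (intro real) auto
next
  case False
  then obtain z :: 'f where z: "conjg z \<noteq> z" by auto
  define w where "w = z - conjg z"
  define i where "i = w / of_real (norm w)"
  have w0: "w \<noteq> 0" using z by (simp add: w_def)
  have cw: "conjg w = - w"
    by (simp add: w_def conjg_diff)
  have ww: "w * w = - (of_real (norm w) * of_real (norm w))"
    using mult_conjg[of w] cw
    by (metis minus_minus mult_minus_right of_real_mult power2_eq_square)
  have ii: "i * i = - 1"
    unfolding i_def using w0 by (simp add: ww)
  have i0: "i \<noteq> 0" using ii by auto
  have "w = i * of_real (norm w)" using w0 by (simp add: i_def)
  then have "conjg i * of_real (norm w) = - i * of_real (norm w)"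
    using cw by (metis conjg_mult conjg_of_real mult_minus_left)
  then have ci: "conjg i = - i"
    using w0 mult_right_cancel[of "of_real (norm w)" "conjg i" "- i"] by simp
  have c: "conjg (of_real a + of_real b * i) = of_real a - of_real b * i" for a b
    by (simp add: conjg_add conjg_mult ci)
  have n: "norm (of_real a + of_real b * i) = norm (Complex a b)" for a b
  proof -
    let ?y = "of_real a + of_real b * i"
    have "of_real ((norm ?y)\<^sup>2) = ?y * (of_real a - of_real b * i)"
      by (metis c mult_conjg)
    also have "\<dots> = of_real a * of_real a - of_real b * of_real b * (i * i)"
      by (simp add: algebra_simps)
    also have "\<dots> = of_real (a\<^sup>2 + b\<^sup>2)" by (simp add: ii power2_eq_square)
    finally have "(norm ?y)\<^sup>2 = a\<^sup>2 + b\<^sup>2" by (simp only: of_real_eq_iff)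
    then show ?thesis by (metis complex_norm norm_ge_zero real_sqrt_unique)
  qed
  have ex: "\<exists>a b. x = of_real a + of_real b * i" for x
  proof -
    have "conjg ((x + conjg x) / 2) = (x + conjg x) / 2"
    proof -
      have "(x + conjg x) / 2 = (x + conjg x) * of_real (1 / 2)" by simp
      then show ?thesis by (metis conjg_add conjg_conjg conjg_mult conjg_of_real add.commute)
    qed
    then obtain a where a: "(x + conjg x) / 2 = of_real a" by (rule conjg_eq_imp_of_real)
    have "conjg ((x - conjg x) * (- i) * of_real (1 / 2)) = (x - conjg x) * (- i) * of_real (1 / 2)"
      unfolding conjg_mult conjg_diff conjg_minus conjg_conjg conjg_of_real ci
      by (simp only: minus_minus) (simp add: algebra_simps)
    then obtain b where b: "(x - conjg x) * (- i) * of_real (1 / 2) = of_real b"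
      by (rule conjg_eq_imp_of_real)
    have "of_real b * i = (x - conjg x) * of_real (1 / 2) * (- (i * i))"
      unfolding b[symmetric] by (simp add: algebra_simps)
    then have "of_real b * i = (x - conjg x) / 2" by (simp add: ii)
    then have "x = of_real a + of_real b * i"
      unfolding a[symmetric] by (simp add: field_simps)
    then show ?thesis by blast
  qed
  have uniq: "a = a' \<and> b = b'"
    if "of_real a + of_real b * i = of_real a' + of_real b' * i" for a b a' b'
  proof -
    have "norm (of_real (a - a') + of_real (b - b') * i) = 0"
      using that by (simp add: algebra_simps)
    then have "Complex (a - a') (b - b') = 0" using n by (metis norm_eq_zero)
    then show ?thesis by (simp add: complex_eq_iff)
  qed
  have "\<exists>!(a, b). x = of_real a + of_real b * i" for x
  proof -
    obtain a b where "x = of_real a + of_real b * i" using ex by blast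
    then show ?thesis
      by (intro ex1I[of _ "(a, b)"]) (use uniq in \<open>auto split: prod.splits\<close>)
  qed
  then show ?thesis using complex[OF ii _ c n] by blast
qed


section \<open>Hilbert spaces over the scalar field\<close>

text \<open>
  The norm, its topology and completeness come from the class \<open>banach\<close>; the locale
  adds the scalar multiplication over the field (extending the real one) and the inner product
  that induces the norm. The inner product is linear in the second argument.
\<close>

locale hilbert_space = vector_space smul
  for smul :: "'f::rc_field \<Rightarrow> 'a::banach \<Rightarrow> 'a" +
  fixes ip :: "'a \<Rightarrow> 'a \<Rightarrow> 'f"
  assumes smul_of_real: "smul (of_real r) x = r *\<^sub>R x"
    and ip_add_right: "ip x (y + z) = ip x y + ip x z"
    and ip_smul_right: "ip x (smul a y) = a * ip x y"
    and ip_conjg: "ip y x = conjg (ip x y)"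
    and ip_self: "ip x x = of_real ((norm x)\<^sup>2)"

lemma hilbert_space_inner:
  "hilbert_space scaleR (inner :: 'a::{real_inner, banach} \<Rightarrow> 'a \<Rightarrow> real)"
  by unfold_locales
    (simp_all add: inner_add_right scaleR_add_right scaleR_add_left inner_commute power2_norm_eq_inner)

lemma hilbert_space_complex: "hilbert_space (*) (\<lambda>x y :: complex. cnj x * y)"
proof unfold_locales
  fix x :: complex
  show "cnj x * x = of_real ((norm x)\<^sup>2)"
    by (subst mult.commute) (rule complex_norm_square[symmetric])
qed (simp_all add: algebra_simps scaleR_conv_of_real)

text \<open>
  Dimension of a subspace as an element of the extended natural numbers. (The library
  dimension is the junk value 0 for infinite-dimensional spaces.)
\<close>

definition edim :: "('f::field \<Rightarrow> 'v::ab_group_add \<Rightarrow> 'v) \<Rightarrow> 'v set \<Rightarrow> enat" where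
  "edim smul V =
    (if \<exists>B. finite B \<and> V \<subseteq> module.span smul B then enat (vector_space.dim smul V) else \<infinity>)"


section \<open>Correlation matrices\<close>

instantiation "fun" :: (type, real_vector) real_vector
begin

definition scaleR_fun :: "real \<Rightarrow> ('a \<Rightarrow> 'b) \<Rightarrow> 'a \<Rightarrow> 'b" where
  "scaleR_fun r f = (\<lambda>x. r *\<^sub>R f x)"

instance
  by standard (auto simp: scaleR_fun_def fun_eq_iff scaleR_add_right scaleR_add_left)

end

text \<open>
  Positive semidefiniteness includes the assertion that the quadratic form takes real values.
\<close>

definition correlation_matrices :: "(nat \<Rightarrow> nat \<Rightarrow> 'f::rc_field) set" where
  "correlation_matrices = {C.
     (\<forall>n m. C m n = conjg (C n m)) \<and>
     (\<forall>n. C n n = 1) \<and>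
     (\<forall>c. finite {n. c n \<noteq> 0} \<longrightarrow>
        (\<exists>r\<ge>0. (\<Sum>n | c n \<noteq> 0. \<Sum>m | c m \<noteq> 0. conjg (c n) * C n m * c m) = of_real r))}"

lemma correlation_matricesD:
  assumes "C \<in> correlation_matrices"
  shows "C m n = conjg (C n m)" and "C n n = 1"
    and "finite {n. c n \<noteq> 0} \<Longrightarrow>
      \<exists>r\<ge>0. (\<Sum>n | c n \<noteq> 0. \<Sum>m | c m \<noteq> 0. conjg (c n) * C n m * c m) = of_real r"
  using assms unfolding correlation_matrices_def by blast+

lemma convex_correlation_matrices:
  "convex (correlation_matrices :: (nat \<Rightarrow> nat \<Rightarrow> 'f::rc_field) set)"
proof (rule convexI)
  fix C D :: "nat \<Rightarrow> nat \<Rightarrow> 'f" and u v :: real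
  assume C: "C \<in> correlation_matrices" and D: "D \<in> correlation_matrices"
    and uv: "0 \<le> u" "0 \<le> v" "u + v = 1"
  have eq: "(u *\<^sub>R C + v *\<^sub>R D) n m = of_real u * C n m + of_real v * D n m" for n m
    by (simp add: scaleR_fun_def scaleR_conv_of_real)
  have "\<exists>r\<ge>0. (\<Sum>n | c n \<noteq> 0. \<Sum>m | c m \<noteq> 0. conjg (c n) * (u *\<^sub>R C + v *\<^sub>R D) n m * c m) = of_real r"
    if c: "finite {n. c n \<noteq> 0}" for c
  proof -
    obtain r where r: "r \<ge> 0"
      "(\<Sum>n | c n \<noteq> 0. \<Sum>m | c m \<noteq> 0. conjg (c n) * C n m * c m) = of_real r"
      using correlation_matricesD(3)[OF C c] by blast
    obtain s where s: "s \<ge> 0"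
      "(\<Sum>n | c n \<noteq> 0. \<Sum>m | c m \<noteq> 0. conjg (c n) * D n m * c m) = of_real s"
      using correlation_matricesD(3)[OF D c] by blast
    have "(\<Sum>n | c n \<noteq> 0. \<Sum>m | c m \<noteq> 0. conjg (c n) * (u *\<^sub>R C + v *\<^sub>R D) n m * c m) =
        of_real u * (\<Sum>n | c n \<noteq> 0. \<Sum>m | c m \<noteq> 0. conjg (c n) * C n m * c m) +
        of_real v * (\<Sum>n | c n \<noteq> 0. \<Sum>m | c m \<noteq> 0. conjg (c n) * D n m * c m)"
      unfolding eq by (simp add: sum_distrib_left sum.distrib algebra_simps)
    also have "\<dots> = of_real (u * r + v * s)" by (simp add: r s)
    finally show ?thesis using r s uv by (intro exI[of _ "u * r + v * s"]) auto
  qed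
  moreover have "(u *\<^sub>R C + v *\<^sub>R D) m n = conjg ((u *\<^sub>R C + v *\<^sub>R D) n m)" for n m
    unfolding eq conjg_add conjg_mult conjg_of_real
    by (simp only: correlation_matricesD(1)[OF C, of m n] correlation_matricesD(1)[OF D, of m n])
  moreover have "(u *\<^sub>R C + v *\<^sub>R D) n n = 1" for n
    using uv unfolding eq
    by (simp add: correlation_matricesD(2)[OF C] correlation_matricesD(2)[OF D] flip: of_real_add)
  ultimately show "u *\<^sub>R C + v *\<^sub>R D \<in> correlation_matrices"
    unfolding correlation_matrices_def by blast
qed

lemma norm_correlation_le_1:
  assumes C: "C \<in> correlation_matrices"
  shows "norm (C n m) \<le> 1"
proof (cases "n = m \<or> C n m = 0")
  case True
  then show ?thesis by (auto simp: correlation_matricesD(2)[OF C])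
next
  case False
  define c where "c = (\<lambda>k. if k = n then 1 else if k = m then - conjg (C n m) else 0)"
  let ?N = "(norm (C n m))\<^sup>2"
  have z: "conjg (C n m) \<noteq> 0" using False by (metis conjg_conjg conjg_zero)
  then have supp: "{k. c k \<noteq> 0} = {n, m}" using False by (auto simp: c_def)
  have h: "C m n = conjg (C n m)" "C n n = 1" "C m m = 1"
    by (rule correlation_matricesD[OF C])+
  obtain r where r: "r \<ge> 0"
    "(\<Sum>k | c k \<noteq> 0. \<Sum>l | c l \<noteq> 0. conjg (c k) * C k l * c l) = of_real r"
    using correlation_matricesD(3)[OF C, of c] supp by auto
  have "(\<Sum>k | c k \<noteq> 0. \<Sum>l | c l \<noteq> 0. conjg (c k) * C k l * c l) = 1 - C n m * conjg (C n m)"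
    unfolding supp using False by (simp add: c_def h conjg_minus algebra_simps)
  also have "\<dots> = of_real (1 - ?N)" by (simp add: mult_conjg)
  finally have "1 - ?N = r" using r(2) by (simp only: of_real_eq_iff)
  then have "?N \<le> 1" using r(1) by simp
  then show ?thesis by (simp add: power_le_one_iff abs_square_le_1)
qed


section \<open>The rank of a correlation matrix\<close>

definition ell1 :: "(nat \<Rightarrow> 'f::rc_field) set" where
  "ell1 = {c. (\<lambda>n. norm (c n)) summable_on UNIV}"

definition ell1_norm :: "(nat \<Rightarrow> 'f::rc_field) \<Rightarrow> real" where
  "ell1_norm c = (\<Sum>\<^sub>\<infinity>n. norm (c n))"

text \<open>
  Functionals on \<open>ell1\<close> are represented by functions that vanish outside \<open>ell1\<close>; continuity of an
  antilinear functional is boundedness.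
\<close>

definition ell1_antidual :: "((nat \<Rightarrow> 'f::rc_field) \<Rightarrow> 'f) set" where
  "ell1_antidual = {F.
     (\<forall>d. d \<notin> ell1 \<longrightarrow> F d = 0) \<and>
     (\<forall>d\<in>ell1. \<forall>e\<in>ell1. F (\<lambda>n. d n + e n) = F d + F e) \<and>
     (\<forall>a. \<forall>d\<in>ell1. F (\<lambda>n. a * d n) = conjg a * F d) \<and>
     (\<exists>K. \<forall>d\<in>ell1. norm (F d) \<le> K * ell1_norm d)}"

definition corr_map ::
    "(nat \<Rightarrow> nat \<Rightarrow> 'f::rc_field) \<Rightarrow> (nat \<Rightarrow> 'f) \<Rightarrow> (nat \<Rightarrow> 'f) \<Rightarrow> 'f" where
  "corr_map C c = (\<lambda>d. if d \<in> ell1 then \<Sum>\<^sub>\<infinity>(n, m). conjg (d n) * C n m * c m else 0)"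

definition corr_rank :: "(nat \<Rightarrow> nat \<Rightarrow> 'f::rc_field) \<Rightarrow> enat" where
  "corr_rank C = edim (\<lambda>a F d. a * F d) (corr_map C ` ell1)"

lemma ell1_add:
  assumes "d \<in> ell1" "e \<in> ell1"
  shows "(\<lambda>n. d n + e n) \<in> ell1"
proof -
  have "(\<lambda>n. norm (d n) + norm (e n)) summable_on UNIV"
    using assms unfolding ell1_def by (intro summable_on_add) blast+
  then have "(\<lambda>n. norm (d n + e n)) summable_on UNIV"
    by (rule summable_on_comparison_test) (rule norm_triangle_ineq norm_ge_zero)+
  then show ?thesis by (simp add: ell1_def)
qed

lemma ell1_scale:
  assumes "d \<in> ell1"
  shows "(\<lambda>n. a * d n) \<in> ell1"
proof -
  have "(\<lambda>n. norm a * norm (d n)) summable_on UNIV"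
    using assms unfolding ell1_def by (intro summable_on_cmult_right) blast
  then show ?thesis by (simp only: ell1_def mem_Collect_eq norm_mult)
qed

lemma corr_map_bound:
  assumes C: "C \<in> correlation_matrices" and c: "c \<in> ell1" and d: "d \<in> ell1"
  shows "(\<lambda>(n, m). norm (conjg (d n) * C n m * c m)) summable_on UNIV"
    and "norm (corr_map C c d) \<le> ell1_norm c * ell1_norm d"
proof -
  let ?f = "\<lambda>(n, m). conjg (d n) * C n m * c m"
  let ?g = "\<lambda>(n, m). norm (d n) * norm (c m)"
  have cs: "(\<lambda>n. norm (c n)) summable_on UNIV" and ds: "(\<lambda>n. norm (d n)) summable_on UNIV"
    using c d by (auto simp: ell1_def)
  have le: "norm (?f p) \<le> ?g p" for p
    using mult_mono[OF mult_left_mono[OF norm_correlation_le_1[OF C, of "fst p" "snd p"]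
          norm_ge_zero[of "d (fst p)"]] order_refl[of "norm (c (snd p))"]]
    by (cases p) (simp add: norm_mult)
  have g: "(?g has_sum (ell1_norm d * ell1_norm c)) (UNIV \<times> UNIV)"
  proof (rule has_sum_SigmaI[where g = "\<lambda>n. norm (d n) * ell1_norm c"])
    show "((\<lambda>m. case (n, m) of (n, m) \<Rightarrow> norm (d n) * norm (c m)) has_sum norm (d n) * ell1_norm c)
        UNIV" for n
      unfolding ell1_norm_def using has_sum_cmult_right[OF has_sum_infsum[OF cs]] by auto
    show "((\<lambda>n. norm (d n) * ell1_norm c) has_sum ell1_norm d * ell1_norm c) UNIV"
      unfolding ell1_norm_def[of d] using has_sum_cmult_left[OF has_sum_infsum[OF ds]] by auto
    show "?g summable_on UNIV \<times> UNIV"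
      using cs ds
      by (intro summable_on_SigmaI[where g = "\<lambda>n. norm (d n) * ell1_norm c"])
        (auto simp: ell1_norm_def intro!: has_sum_cmult_right summable_on_cmult_left has_sum_infsum)
  qed
  then have gs: "?g summable_on UNIV" by (auto simp: summable_on_def)
  have fs: "(\<lambda>p. norm (?f p)) summable_on UNIV"
    by (rule summable_on_comparison_test[OF gs]) (use le in auto)
  then show "(\<lambda>(n, m). norm (conjg (d n) * C n m * c m)) summable_on UNIV"
    by (simp add: case_prod_unfold)
  have "norm (infsum ?f UNIV) \<le> infsum (\<lambda>p. norm (?f p)) UNIV"
    by (rule norm_infsum_bound) (use fs in auto)
  also have "\<dots> \<le> infsum ?g UNIV"
    by (rule infsum_mono[OF fs gs]) (use le in auto)
  also have "\<dots> = ell1_norm c * ell1_norm d"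
    using infsumI[OF g] by (simp add: mult.commute)
  finally show "norm (corr_map C c d) \<le> ell1_norm c * ell1_norm d"
    using d by (simp add: corr_map_def)
qed

lemma corr_map_in_antidual:
  assumes C: "C \<in> correlation_matrices" and c: "c \<in> ell1"
  shows "corr_map C c \<in> ell1_antidual"
proof -
  have s: "(\<lambda>(n, m). conjg (d n) * C n m * c m) summable_on UNIV" if "d \<in> ell1" for d
    by (rule abs_summable_summable)
      (use corr_map_bound(1)[OF C c that] in \<open>simp add: case_prod_unfold\<close>)
  have "corr_map C c (\<lambda>n. d n + e n) = corr_map C c d + corr_map C c e"
    if "d \<in> ell1" "e \<in> ell1" for d e
    using that infsum_add[OF s[OF that(1)] s[OF that(2)]]
    by (simp add: corr_map_def ell1_add conjg_add algebra_simps case_prod_unfold)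
  moreover have "corr_map C c (\<lambda>n. a * d n) = conjg a * corr_map C c d" if "d \<in> ell1" for a d
    using that infsum_cmult_right[OF s[OF that], of "conjg a"]
    by (simp add: corr_map_def ell1_scale conjg_mult algebra_simps case_prod_unfold)
  moreover have "\<exists>K. \<forall>d\<in>ell1. norm (corr_map C c d) \<le> K * ell1_norm d"
    using corr_map_bound(2)[OF C c] by blast
  ultimately show ?thesis
    by (auto simp: ell1_antidual_def corr_map_def)
qed

end

theory Submission
  imports Defs
begin

text \<open>
  Extremality: if the Gram matrix \<open>C\<close> of the vectors \<open>\<phi> n / \<parallel>\<phi> n\<parallel>\<close> lies in the open segment between
  correlation matrices \<open>A\<close> and \<open>B\<close>, then the quadratic form of \<open>A\<close> is bounded by a multiple of that
  of \<open>C\<close>, hence continuous for the norm of the Hilbert space. As it agrees with the squared norm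
  on the dense set of all \<open>\<phi> n\<close>, it is at most the form of \<open>C\<close>; evaluated at
  \<open>e\<^sub>n + cnj (A\<^sub>n\<^sub>m - C\<^sub>n\<^sub>m) e\<^sub>m\<close> this forces \<open>A\<^sub>n\<^sub>m = C\<^sub>n\<^sub>m\<close>.

  Rank: \<open>C\<close> factors through the synthesis map \<open>c \<mapsto> \<Sum> c\<^sub>n \<phi> n / \<parallel>\<phi> n\<parallel>\<close> from \<open>ell1\<close>. By density every
  vector is an absolutely convergent series of members of the sequence, so this map is onto, and
  it is followed by a linear injection of the Hilbert space into the functionals on \<open>ell1\<close>.
\<close>

section \<open>Hilbert spaces\<close>

context hilbert_space
begin

lemma ip_add_left: "ip (x + y) z = ip x z + ip y z"
  by (metis conjg_add ip_add_right ip_conjg)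

lemma ip_smul_left: "ip (smul a x) y = conjg a * ip x y"
  by (metis conjg_mult ip_conjg ip_smul_right)

lemma ip_zero_left [simp]: "ip 0 x = 0"
  using ip_add_left[of 0 0 x] by simp

lemma ip_zero_right [simp]: "ip x 0 = 0"
  using ip_add_right[of x 0 0] by simp

lemma ip_diff_right: "ip x (y - z) = ip x y - ip x z"
  using ip_add_right[of x "y - z" z] by simp

lemma ip_diff_left: "ip (x - y) z = ip x z - ip y z"
  using ip_add_left[of "x - y" y z] by simp

lemma ip_sum_right: "ip x (sum f A) = (\<Sum>i\<in>A. ip x (f i))"
  by (induction A rule: infinite_finite_induct) (simp_all add: ip_add_right)

lemma ip_sum_left: "ip (sum f A) x = (\<Sum>i\<in>A. ip (f i) x)"
  by (induction A rule: infinite_finite_induct) (simp_all add: ip_add_left)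

lemma ip_scaleR_right: "ip x (r *\<^sub>R y) = of_real r * ip x y"
  by (metis ip_smul_right smul_of_real)

lemma ip_scaleR_left: "ip (r *\<^sub>R x) y = of_real r * ip x y"
  by (metis conjg_of_real ip_smul_left smul_of_real)

lemma norm_smul: "norm (smul a x) = norm a * norm x"
proof -
  have "(of_real ((norm (smul a x))\<^sup>2) :: 'f) = (a * conjg a) * ip x x"
    by (simp only: ip_self[symmetric] ip_smul_left ip_smul_right mult_ac)
  also have "\<dots> = of_real ((norm a)\<^sup>2) * of_real ((norm x)\<^sup>2)"
    by (simp only: mult_conjg ip_self)
  also have "\<dots> = of_real ((norm a * norm x)\<^sup>2)"
    by (simp add: power_mult_distrib)
  finally have "(norm (smul a x))\<^sup>2 = (norm a * norm x)\<^sup>2"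
    by (simp only: of_real_eq_iff)
  then show ?thesis by (simp add: power2_eq_iff_nonneg)
qed

lemma norm_ip_le: "norm (ip x y) \<le> norm x * norm y"
proof (cases "x = 0")
  case False
  let ?N = "(norm x)\<^sup>2" and ?a = "ip x y"
  \<comment> \<open>Cauchy-Schwarz: \<open>z\<close> is the component of \<open>y\<close> orthogonal
    to \<open>x\<close>, multiplied by \<open>?N\<close> to avoid a division; its squared norm is
    nonnegative.\<close>
  define z where "z = ?N *\<^sub>R y - smul ?a x"
  have yx: "ip y x = conjg ?a" by (rule ip_conjg)
  have "(of_real ((norm z)\<^sup>2) :: 'f) = ip z z" by (simp only: ip_self)
  also have "\<dots> = of_real ?N * (of_real ?N * ip y y) - of_real ?N * (?a * conjg ?a)
      - of_real ?N * (?a * conjg ?a) + (?a * conjg ?a) * ip x x"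
    unfolding z_def
    by (simp add: ip_diff_left ip_diff_right ip_scaleR_left ip_scaleR_right ip_smul_left
        ip_smul_right yx algebra_simps)
  also have "\<dots> = of_real (?N * (?N * (norm y)\<^sup>2 - (norm ?a)\<^sup>2))"
    unfolding ip_self mult_conjg of_real_mult of_real_diff by (simp add: algebra_simps)
  finally have "0 \<le> ?N * (?N * (norm y)\<^sup>2 - (norm ?a)\<^sup>2)"
    by (metis of_real_eq_iff zero_le_power2)
  then have "(norm ?a)\<^sup>2 \<le> (norm x * norm y)\<^sup>2"
    using False by (simp add: zero_le_mult_iff power_mult_distrib)
  then show ?thesis by (rule power2_le_imp_le) simp
qed simp

lemma bounded_linear_ip_right: "bounded_linear (ip x)"
  by (rule bounded_linear_intro[where K = "norm x"])
    (simp_all add: ip_add_right ip_scaleR_right scaleR_conv_of_real norm_ip_le mult.commute[of _ "norm x"])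

text \<open>The zero set of the continuous map \<open>ip x\<close> is closed and contains
  \<open>A\<close>, hence contains \<open>x\<close> itself.\<close>

lemma ip_dense_eq_0:
  assumes "closure A = UNIV" and "\<And>y. y \<in> A \<Longrightarrow> ip y x = 0"
  shows "x = 0"
proof -
  have "closed {y. ip x y = 0}"
    by (intro closed_Collect_eq continuous_on_const linear_continuous_on bounded_linear_ip_right)
  moreover have "A \<subseteq> {y. ip x y = 0}"
    using assms(2) by (metis (mono_tags, lifting) conjg_zero ip_conjg mem_Collect_eq subsetI)
  ultimately have "ip x x = 0"
    using assms(1) closure_minimal[of A "{y. ip x y = 0}"] by blast
  then show ?thesis by (simp add: ip_self)
qed

end


section \<open>Quadratic forms of matrices\<close>

text \<open>The index set is explicit so that forms of several finitely supported sequences can be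
  compared over one common set.\<close>

definition qform :: "(nat \<Rightarrow> nat \<Rightarrow> 'f::rc_field) \<Rightarrow> nat set \<Rightarrow> (nat \<Rightarrow> 'f) \<Rightarrow> 'f" where
  "qform M S c = (\<Sum>n\<in>S. \<Sum>m\<in>S. conjg (c n) * M n m * c m)"

lemma qform_support:
  assumes "finite S" "{n. c n \<noteq> 0} \<subseteq> S"
  shows "qform M {n. c n \<noteq> 0} c = qform M S c"
proof -
  have "(\<Sum>m | c m \<noteq> 0. conjg (c n) * M n m * c m) = (\<Sum>m\<in>S. conjg (c n) * M n m * c m)" for n
    by (rule sum.mono_neutral_left) (use assms in auto)
  then show ?thesis
    unfolding qform_def by simp (rule sum.mono_neutral_left, use assms in auto)
qed

lemma qform_correlation_nonneg:
  assumes "M \<in> correlation_matrices" "finite S" "{n. c n \<noteq> 0} \<subseteq> S"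
  obtains r where "r \<ge> 0" "qform M S c = of_real r"
  using correlation_matricesD(3)[OF assms(1), of c] qform_support[OF assms(2,3), of M]
    finite_subset[OF assms(3,2)]
  unfolding qform_def by metis

text \<open>A weighted triangle inequality: nonnegativity of the form at \<open>s c - z\<close>
  bounds the cross terms. As \<open>s\<close> grows, the weight of \<open>b\<close> tends to 1 at
  the expense of that of \<open>a\<close>.\<close>

lemma qform_add_le:
  assumes "M \<in> correlation_matrices" "finite S" "{n. c n \<noteq> 0} \<subseteq> S" "{n. z n \<noteq> 0} \<subseteq> S"
    and "qform M S c = of_real a" "qform M S z = of_real b"
    and "qform M S (\<lambda>n. c n + z n) = of_real r" and "s > 0"
  shows "r \<le> (1 + s) * a + (1 + 1 / s) * b"
proof -
  let ?w = "\<lambda>n. of_real s * c n - z n"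
  have "c n = 0 \<and> z n = 0" if "n \<notin> S" for n
    using that assms(3,4) by auto
  then have "{n. ?w n \<noteq> 0} \<subseteq> S" by fastforce
  then obtain w where w: "w \<ge> 0" "qform M S ?w = of_real w"
    by (rule qform_correlation_nonneg[OF assms(1,2)])
  \<comment> \<open>A weighted parallelogram identity, in which the cross terms cancel.\<close>
  have "qform M S ?w + of_real s * qform M S (\<lambda>n. c n + z n) =
      of_real (s * (1 + s)) * qform M S c + of_real (1 + s) * qform M S z"
    unfolding qform_def sum_distrib_left sum.distrib[symmetric]
    by (intro sum.cong refl) (simp add: conjg_add conjg_diff conjg_mult algebra_simps)
  then have "(of_real (w + s * r) :: 'a) = of_real (s * (1 + s) * a + (1 + s) * b)"
    by (simp add: w assms(5-7))
  then have "w + s * r = s * (1 + s) * a + (1 + s) * b" by (simp only: of_real_eq_iff)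
  then have "s * r \<le> s * (1 + s) * a + (1 + s) * b" using w by simp
  also have "\<dots> = s * ((1 + s) * a + (1 + 1 / s) * b)"
    using \<open>s > 0\<close> by (simp add: field_simps)
  finally show ?thesis using \<open>s > 0\<close> by simp
qed


section \<open>Dimension\<close>

context vector_space
begin

text \<open>An independent set inside the span of a finite set is finite, so an infinite basis rules
  out any finite spanning set.\<close>

lemma edim_basis:
  assumes "independent B" "span B = V"
  shows "edim scale V = (if finite B then enat (card B) else \<infinity>)"
proof -
  have "finite B" if "finite A" "V \<subseteq> span A" for A
    using that assms by (metis independent_span_bound span_superset order_trans)
  moreover have "dim V = card B"
    using assms by (metis dim_eq_card span_span)
  ultimately show ?thesis
    using assms unfolding edim_def by auto
qed

end

text \<open>Injectivity carries a basis to a basis of the range and preserves both finiteness and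
  cardinality.\<close>

lemma edim_linear_image:
  assumes "Vector_Spaces.linear s1 s2 f" "inj f"
  shows "edim s2 (range f) = edim s1 UNIV"
proof -
  interpret Vector_Spaces.linear s1 s2 f by fact
  obtain B where B: "vs1.independent B" "vs1.span B = UNIV"
    by (metis vs1.maximal_independent_subset subset_UNIV top.extremum_uniqueI)
  have "vs2.independent (f ` B)"
    using B(1) assms(2) by (intro independent_injective_image) (auto intro: inj_on_subset)
  moreover have "vs2.span (f ` B) = range f"
    using B(2) span_image[of B] by simp
  ultimately show ?thesis
    using vs1.edim_basis[OF B] vs2.edim_basis[of "f ` B"]
      inj_on_subset[OF assms(2), of B]
    by (simp add: card_image finite_image_iff)
qed


section \<open>Normalised dense sequences\<close>

locale dense_sequence = hilbert_space smul ip
  for smul :: "'f::rc_field \<Rightarrow> 'a::banach \<Rightarrow> 'a" and ip :: "'a \<Rightarrow> 'a \<Rightarrow> 'f" +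
  fixes \<phi> :: "nat \<Rightarrow> 'a"
  assumes nonzero: "\<phi> n \<noteq> 0"
    and dense: "closure (range \<phi>) = UNIV"
begin

definition \<psi> :: "nat \<Rightarrow> 'a" where "\<psi> n = inverse (norm (\<phi> n)) *\<^sub>R \<phi> n"

definition gram :: "nat \<Rightarrow> nat \<Rightarrow> 'f" where "gram n m = ip (\<psi> n) (\<psi> m)"

lemma norm_\<psi> [simp]: "norm (\<psi> n) = 1"
  using nonzero by (simp add: \<psi>_def)

lemma scaleR_\<psi>: "norm (\<phi> n) *\<^sub>R \<psi> n = \<phi> n"
  using nonzero by (simp add: \<psi>_def)

lemma approx: "e > 0 \<Longrightarrow> \<exists>k. norm (x - \<phi> k) < e"
  using dense closure_approachable[of x "range \<phi>"] by (auto simp: dist_norm norm_minus_commute)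

text \<open>By sesquilinearity the double sum is the inner product of the synthesised vector with
  itself. Positivity of \<open>gram\<close> and its control by the norm both come from here.\<close>

lemma qform_gram:
  "qform gram S c = of_real ((norm (\<Sum>n\<in>S. smul (c n) (\<psi> n)))\<^sup>2)"
  unfolding ip_self[symmetric] qform_def gram_def ip_sum_left
  by (simp add: ip_sum_right ip_smul_left ip_smul_right sum_distrib_left mult_ac)

lemma gram_correlation: "gram \<in> correlation_matrices"
proof -
  have "gram m n = conjg (gram n m)" for n m
    unfolding gram_def by (rule ip_conjg)
  moreover have "gram n n = 1" for n
    by (simp add: gram_def ip_self)
  moreover have "\<exists>r\<ge>0. (\<Sum>n | c n \<noteq> 0. \<Sum>m | c m \<noteq> 0. conjg (c n) * gram n m * c m) = of_real r" for c
    using qform_gram[of "{n. c n \<noteq> 0}" c] unfolding qform_def by (metis zero_le_power2)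
  ultimately show ?thesis unfolding correlation_matrices_def by blast
qed

section \<open>Extremality of the Gram matrix\<close>

text \<open>
  Every vector is approximated by some \<open>\<phi> k\<close>, on which the form of \<open>A\<close> takes the value
  \<open>(norm (\<phi> k))\<^sup>2\<close> because \<open>A\<close> has unit diagonal; the domination of \<open>A\<close> by a multiple of the
  Gram matrix makes the form of the difference negligible.
\<close>

lemma dominated_qform_le:
  assumes A: "A \<in> correlation_matrices"
    and dom: "\<And>S c a b. finite S \<Longrightarrow> {n. c n \<noteq> 0} \<subseteq> S \<Longrightarrow> qform A S c = of_real a \<Longrightarrow>
      qform gram S c = of_real b \<Longrightarrow> a \<le> K * b"
    and S: "finite S" "{n. c n \<noteq> 0} \<subseteq> S"
    and q: "qform A S c = of_real r" "qform gram S c = of_real t"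
  shows "r \<le> t"
proof -
  define x where "x = (\<Sum>n\<in>S. smul (c n) (\<psi> n))"
  have t: "t = (norm x)\<^sup>2"
    using q(2) unfolding qform_gram x_def by (metis of_real_eq_iff)
  have "\<forall>j. \<exists>k. norm (x - \<phi> k) < inverse (real (Suc j))"
    using approx by simp
  then obtain k where k: "\<And>j. norm (x - \<phi> (k j)) < inverse (real (Suc j))" by metis
  have lim0: "(\<lambda>j. norm (x - \<phi> (k j))) \<longlonglongrightarrow> 0"
    by (rule real_tendsto_sandwich[OF _ _ tendsto_const LIMSEQ_inverse_real_of_nat])
      (intro always_eventually allI norm_ge_zero less_imp_le[OF k])+
  then have "(\<lambda>j. x - (x - \<phi> (k j))) \<longlonglongrightarrow> x - 0"
    by (intro tendsto_diff tendsto_const) (simp only: tendsto_norm_zero_iff)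
  then have limn: "(\<lambda>j. norm (\<phi> (k j))) \<longlonglongrightarrow> norm x"
    by (simp add: tendsto_norm)
  \<comment> \<open>The small remainder receives the large weight \<open>1 + s\<close>, the
    approximant the weight \<open>1 + 1 / s\<close>, which can be brought close to 1.\<close>
  have step: "r \<le> (1 + s) * (K * (norm (x - \<phi> (k j)))\<^sup>2) + (1 + 1 / s) * (norm (\<phi> (k j)))\<^sup>2"
    if "s > 0" for s j
  proof -
    let ?T = "insert (k j) S"
    \<comment> \<open>The coefficient undoes the normalisation: \<open>z\<close> synthesises
      \<open>\<phi> (k j)\<close>, and \<open>d\<close> the remainder
      \<open>x - \<phi> (k j)\<close>.\<close>
    define z :: "nat \<Rightarrow> 'f" where "z = (\<lambda>n. if n = k j then of_real (norm (\<phi> (k j))) else 0)"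
    define d where "d = (\<lambda>n. c n - z n)"
    have T: "finite ?T" using S by simp
    have zT: "{n. z n \<noteq> 0} \<subseteq> ?T" by (auto simp: z_def)
    have dT: "{n. d n \<noteq> 0} \<subseteq> ?T" using S by (auto simp: z_def d_def)
    have cT: "{n. c n \<noteq> 0} \<subseteq> ?T" using S by auto
    have "{n. z n \<noteq> 0} = {k j}" using nonzero by (auto simp: z_def)
    then have qz: "qform A ?T z = of_real ((norm (\<phi> (k j)))\<^sup>2)"
      using qform_support[OF T zT, of A] correlation_matricesD(2)[OF A, of "k j"]
      by (simp add: qform_def z_def power2_eq_square)
    obtain a where a: "qform A ?T d = of_real a"
      using qform_correlation_nonneg[OF A T dT] by blast
    have "(\<Sum>n\<in>?T. smul (c n) (\<psi> n)) = x"
      unfolding x_def by (rule sum.mono_neutral_right) (use S in auto)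
    moreover have "(\<Sum>n\<in>?T. smul (z n) (\<psi> n)) = (\<Sum>n\<in>{k j}. smul (z n) (\<psi> n))"
      by (rule sum.mono_neutral_right) (use S in \<open>auto simp: z_def\<close>)
    ultimately have "(\<Sum>n\<in>?T. smul (d n) (\<psi> n)) = x - \<phi> (k j)"
      unfolding d_def scale_left_diff_distrib sum_subtractf
      by (simp add: z_def smul_of_real scaleR_\<psi>)
    then have "qform gram ?T d = of_real ((norm (x - \<phi> (k j)))\<^sup>2)"
      unfolding qform_gram by simp
    then have "a \<le> K * (norm (x - \<phi> (k j)))\<^sup>2"
      by (rule dom[OF T dT a])
    moreover have "qform A ?T (\<lambda>n. d n + z n) = of_real r"
      using qform_support[OF T cT, of A] qform_support[OF S, of A] q(1) by (simp add: d_def)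
    then have "r \<le> (1 + s) * a + (1 + 1 / s) * (norm (\<phi> (k j)))\<^sup>2"
      by (rule qform_add_le[OF A T dT zT a qz _ that])
    ultimately show ?thesis
      using that mult_left_mono[of a "K * (norm (x - \<phi> (k j)))\<^sup>2" "1 + s"] by linarith
  qed
  \<comment> \<open>First \<open>j\<close> tends to infinity with \<open>s\<close> fixed, which
    removes the term with \<open>K\<close>.\<close>
  have bound: "r \<le> (1 + 1 / s) * (norm x)\<^sup>2" if "s > 0" for s
  proof -
    have "(\<lambda>j. (1 + s) * (K * (norm (x - \<phi> (k j)))\<^sup>2) + (1 + 1 / s) * (norm (\<phi> (k j)))\<^sup>2)
        \<longlonglongrightarrow> (1 + s) * (K * 0\<^sup>2) + (1 + 1 / s) * (norm x)\<^sup>2"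
      by (intro tendsto_intros lim0 limn)
    then have "r \<le> (1 + s) * (K * 0\<^sup>2) + (1 + 1 / s) * (norm x)\<^sup>2"
      by (rule LIMSEQ_le_const) (use step[OF that] in blast)
    then show ?thesis by simp
  qed
  \<comment> \<open>Then \<open>s = Suc j\<close> tends to infinity.\<close>
  have "(\<lambda>j. (1 + inverse (real (Suc j))) * (norm x)\<^sup>2) \<longlonglongrightarrow> (1 + 0) * (norm x)\<^sup>2"
    by (intro tendsto_intros LIMSEQ_inverse_real_of_nat)
  then have "r \<le> (1 + 0) * (norm x)\<^sup>2"
    by (rule LIMSEQ_le_const)
      (use bound[of "real (Suc _)"] in \<open>simp add: inverse_eq_divide\<close>)
  then show ?thesis by (simp add: t)
qed

text \<open>A one-sided comparison of forms suffices because a test sequence can choose the phase of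
  the cross terms.\<close>

lemma dominated_eq_gram:
  assumes A: "A \<in> correlation_matrices"
    and dom: "\<And>S c a b. finite S \<Longrightarrow> {n. c n \<noteq> 0} \<subseteq> S \<Longrightarrow> qform A S c = of_real a \<Longrightarrow>
      qform gram S c = of_real b \<Longrightarrow> a \<le> K * b"
  shows "A = gram"
proof -
  have "A n m = gram n m" for n m
  proof (cases "n = m")
    case True
    then show ?thesis
      using correlation_matricesD(2)[OF A] correlation_matricesD(2)[OF gram_correlation] by simp
  next
    case False
    let ?D = "A n m - gram n m"
    \<comment> \<open>The coefficient \<open>conjg ?D\<close> makes both cross terms of the
      difference of the forms equal to \<open>?D * conjg ?D\<close>; the remaining terms agree for
      all correlation matrices.\<close>
    define c where "c = (\<lambda>k. if k = n then 1 else if k = m then conjg ?D else 0)"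
    have S: "finite {n, m}" "{k. c k \<noteq> 0} \<subseteq> {n, m}" by (auto simp: c_def)
    have exp: "qform M {n, m} c = 1 + M n m * conjg ?D + ?D * conjg (M n m) + ?D * conjg ?D"
      if M: "M \<in> correlation_matrices" for M
      using False correlation_matricesD(2)[OF M] correlation_matricesD(1)[OF M, of m n]
      by (simp add: qform_def c_def algebra_simps)
    obtain r where r: "qform A {n, m} c = of_real r"
      using qform_correlation_nonneg[OF A S] by blast
    obtain t where t: "qform gram {n, m} c = of_real t"
      using qform_correlation_nonneg[OF gram_correlation S] by blast
    have "r \<le> t" by (rule dominated_qform_le[OF A dom S r t])
    moreover have "(of_real (r - t) :: 'f) = of_real (2 * (norm ?D)\<^sup>2)"
    proof -
      have "(of_real (r - t) :: 'f) = qform A {n, m} c - qform gram {n, m} c"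
        by (simp add: r t)
      also have "\<dots> = ?D * conjg ?D + ?D * conjg ?D"
        unfolding exp[OF A] exp[OF gram_correlation] by (simp add: conjg_diff algebra_simps)
      also have "\<dots> = of_real (2 * (norm ?D)\<^sup>2)"
        unfolding mult_conjg by simp
      finally show ?thesis .
    qed
    then have "r - t = 2 * (norm ?D)\<^sup>2" by (simp only: of_real_eq_iff)
    ultimately have "(norm ?D)\<^sup>2 \<le> 0" by linarith
    then show ?thesis by simp
  qed
  then show ?thesis by blast
qed

lemma gram_extreme: "gram extreme_point_of correlation_matrices"
  unfolding extreme_point_of_def
proof (intro conjI gram_correlation ballI notI)
  fix A B :: "nat \<Rightarrow> nat \<Rightarrow> 'f"
  assume A: "A \<in> correlation_matrices" and B: "B \<in> correlation_matrices"
    and "gram \<in> open_segment A B"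
  then obtain u where AB: "A \<noteq> B" and u: "0 < u" "u < 1" and g: "gram = (1 - u) *\<^sub>R A + u *\<^sub>R B"
    by (auto simp: in_segment)
  \<comment> \<open>Dropping the nonnegative form of \<open>B\<close> from the convex combination
    and solving for \<open>a\<close> gives the constant \<open>1 / (1 - u)\<close>.\<close>
  have "a \<le> (1 / (1 - u)) * b"
    if S: "finite S" "{n. c n \<noteq> 0} \<subseteq> S" and a: "qform A S c = of_real a"
      and b: "qform gram S c = of_real b" for S c a b
  proof -
    obtain e where e: "e \<ge> 0" "qform B S c = of_real e"
      using qform_correlation_nonneg[OF B S] by blast
    have "qform gram S c = of_real (1 - u) * qform A S c + of_real u * qform B S c"
      unfolding g qform_def sum_distrib_left sum.distrib[symmetric]
      by (intro sum.cong refl) (simp add: scaleR_fun_def scaleR_conv_of_real algebra_simps)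
    then have "(of_real b :: 'f) = of_real ((1 - u) * a + u * e)" by (simp add: a b e)
    then have "b = (1 - u) * a + u * e" by (simp only: of_real_eq_iff)
    moreover have "0 \<le> u * e" using u e by simp
    ultimately show ?thesis using u by (simp add: field_simps)
  qed
  then have "A = gram" by (rule dominated_eq_gram[OF A])
  then have "u *\<^sub>R A = u *\<^sub>R B" using g by (simp add: algebra_simps)
  then show False using u AB by simp
qed

end


section \<open>The rank\<close>

context dense_sequence
begin

text \<open>The adjoint of synthesis: \<open>d\<close> is sent to the inner product of
  \<open>synth d\<close> with \<open>x\<close>. Like \<open>corr_map\<close> it is 0 outside
  \<open>ell1\<close>, so that the two can be equal as functions.\<close>

definition functional :: "'a \<Rightarrow> (nat \<Rightarrow> 'f) \<Rightarrow> 'f" where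
  "functional x = (\<lambda>d. if d \<in> ell1 then \<Sum>\<^sub>\<infinity>n. conjg (d n) * ip (\<psi> n) x else 0)"

lemma functional_summable:
  assumes "d \<in> ell1"
  shows "(\<lambda>n. conjg (d n) * ip (\<psi> n) x) summable_on UNIV"
proof (rule abs_summable_summable)
  have "(\<lambda>n. norm (d n) * norm x) summable_on UNIV"
    using assms by (intro summable_on_cmult_left) (simp add: ell1_def)
  then show "(\<lambda>n. norm (conjg (d n) * ip (\<psi> n) x)) summable_on UNIV"
    by (rule summable_on_comparison_test)
      (use norm_ip_le[of "\<psi> _" x] in \<open>auto simp: norm_mult intro: mult_left_mono\<close>)
qed

lemma linear_functional: "Vector_Spaces.linear smul (\<lambda>a F d. a * F d) functional"
proof -
  have "vector_space (\<lambda>(a::'f) (F :: (nat \<Rightarrow> 'f) \<Rightarrow> 'f) d. a * F d)"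
    by unfold_locales (auto simp: fun_eq_iff algebra_simps)
  moreover have "functional (x + y) = functional x + functional y" for x y
    using infsum_add[OF functional_summable functional_summable]
    by (auto simp: functional_def fun_eq_iff ip_add_right algebra_simps)
  moreover have "functional (smul a x) = (\<lambda>d. a * functional x d)" for a x
    using infsum_cmult_right[OF functional_summable, where c = a]
    by (auto simp: functional_def fun_eq_iff ip_smul_right algebra_simps)
  ultimately show ?thesis
    using vector_space_axioms by (simp add: Vector_Spaces.linear_iff)
qed

text \<open>Unit sequences recover all \<open>ip (\<psi> n) x\<close>, and density of the
  \<open>\<phi> n\<close> makes these determine \<open>x\<close>.\<close>

lemma inj_functional: "inj functional"
proof (rule injI)
  fix x y assume eq: "functional x = functional y"
  have "ip (\<psi> n) x = ip (\<psi> n) y" for n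
  proof -
    define d :: "nat \<Rightarrow> 'f" where "d = (\<lambda>m. if m = n then 1 else 0)"
    have "(\<lambda>m. norm (d m)) summable_on UNIV"
      using summable_on_cong_neutral[of "{n}" UNIV "\<lambda>m. norm (d m)" "\<lambda>m. norm (d m)"]
      by (simp add: d_def)
    then have d: "d \<in> ell1" by (simp add: ell1_def)
    have "functional z d = ip (\<psi> n) z" for z
    proof -
      have "functional z d = (\<Sum>\<^sub>\<infinity>m\<in>{n}. conjg (d m) * ip (\<psi> m) z)"
        using d unfolding functional_def
        by (simp only: if_True) (rule infsum_cong_neutral, auto simp: d_def)
      then show ?thesis by (simp add: d_def)
    qed
    then show ?thesis using eq by metis
  qed
  then have "ip (\<phi> n) (x - y) = 0" for n
    by (subst scaleR_\<psi>[symmetric]) (simp add: ip_scaleR_left ip_diff_right)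
  then have "x - y = 0"
    by (intro ip_dense_eq_0[OF dense]) auto
  then show "x = y" by simp
qed

section \<open>The synthesis map and its surjectivity\<close>

definition synth :: "(nat \<Rightarrow> 'f) \<Rightarrow> 'a" where
  "synth c = (\<Sum>\<^sub>\<infinity>n. smul (c n) (\<psi> n))"

lemma synth_has_sum:
  assumes "c \<in> ell1"
  shows "((\<lambda>n. smul (c n) (\<psi> n)) has_sum synth c) UNIV"
  unfolding synth_def
  by (rule has_sum_infsum[OF abs_summable_summable])
    (use assms in \<open>simp add: norm_smul ell1_def\<close>)

text \<open>Absolute convergence allows the sum over \<open>m\<close> to be taken first, and
  continuity of \<open>ip (\<psi> n)\<close> moves it inside the inner product.\<close>

lemma corr_map_gram:
  assumes c: "c \<in> ell1"
  shows "corr_map gram c = functional (synth c)"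
proof
  fix d
  show "corr_map gram c d = functional (synth c) d"
  proof (cases "d \<in> ell1")
    case d: True
    have s: "(\<lambda>(n, m). conjg (d n) * gram n m * c m) summable_on UNIV \<times> UNIV"
      by (rule abs_summable_summable)
        (use corr_map_bound(1)[OF gram_correlation c d] in \<open>simp add: case_prod_unfold\<close>)
    have inner: "(\<Sum>\<^sub>\<infinity>m. conjg (d n) * gram n m * c m) = conjg (d n) * ip (\<psi> n) (synth c)" for n
    proof -
      have "((ip (\<psi> n) \<circ> (\<lambda>m. smul (c m) (\<psi> m))) has_sum ip (\<psi> n) (synth c)) UNIV"
        using has_sum_bounded_linear[OF bounded_linear_ip_right synth_has_sum[OF c]]
        by (simp add: o_def)
      then have "((\<lambda>m. conjg (d n) * (c m * ip (\<psi> n) (\<psi> m))) has_sum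
          conjg (d n) * ip (\<psi> n) (synth c)) UNIV"
        by (intro has_sum_cmult_right) (simp add: o_def ip_smul_right)
      then show ?thesis
        by (intro infsumI) (simp add: gram_def mult_ac)
    qed
    show ?thesis
      using d infsum_Sigma'_banach[OF s]
      by (simp add: corr_map_def functional_def inner)
  qed (simp add: corr_map_def functional_def)
qed

text \<open>Greedy expansion: each remainder is approximated by a member of the sequence, with
  geometrically decreasing error.\<close>

lemma has_sum_subsequence:
  obtains k :: "nat \<Rightarrow> nat"
  where "((\<lambda>j. \<phi> (k j)) has_sum x) UNIV" "(\<lambda>j. norm (\<phi> (k j))) summable_on UNIV"
proof -
  define K where "K = (\<lambda>y j. SOME k. norm (y - \<phi> k) < (1/2) ^ j)"
  have K: "norm (y - \<phi> (K y j)) < (1/2) ^ j" for y j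
    unfolding K_def by (rule someI_ex) (simp add: approx)
  \<comment> \<open>\<open>X j\<close> is what remains of \<open>x\<close> after subtracting the
    first \<open>j\<close> chosen terms.\<close>
  define X where "X = rec_nat x (\<lambda>j y. y - \<phi> (K y j))"
  have X0: "X 0 = x" and XS: "X (Suc j) = X j - \<phi> (K (X j) j)" for j
    by (simp_all add: X_def)
  define k where "k = (\<lambda>j. K (X j) j)"
  have small: "norm (X (Suc j)) < (1/2) ^ j" for j
    unfolding XS by (rule K)
  have XS': "\<phi> (k j) = X j - X (Suc j)" for j
    by (simp add: XS k_def)
  have "(\<lambda>j. X (Suc j)) \<longlonglongrightarrow> 0"
    by (rule Lim_null_comparison[OF _ LIMSEQ_power_zero[of "1/2::real"]])
      (auto intro!: always_eventually less_imp_le[OF small])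
  then have "X \<longlonglongrightarrow> 0" by (simp only: filterlim_sequentially_Suc)
  then have sums: "(\<lambda>j. \<phi> (k j)) sums x"
    using telescope_sums'[of X 0] by (simp add: XS' X0)
  \<comment> \<open>Index 0 is left out because \<open>X 0 = x\<close> may be arbitrarily large; a
    single term does not affect summability.\<close>
  have "norm (\<phi> (k (Suc j))) \<le> 2 * (1/2) ^ j" for j
  proof -
    have "norm (\<phi> (k (Suc j))) \<le> norm (X (Suc j)) + norm (X (Suc (Suc j)))"
      unfolding XS' by (rule norm_triangle_ineq4)
    also have "\<dots> \<le> (1/2) ^ j + (1/2) ^ Suc j"
      using small[of j] small[of "Suc j"] by linarith
    also have "\<dots> \<le> 2 * (1/2) ^ j" by simp
    finally show ?thesis .
  qed
  then have bound: "norm (norm (\<phi> (k (Suc j)))) \<le> 2 * (1/2) ^ j" for j by simp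
  have "summable (\<lambda>j. 2 * (1/2 :: real) ^ j)"
    by (rule summable_mult[OF summable_geometric]) simp
  then have "summable (\<lambda>j. norm (\<phi> (k (Suc j))))"
    by (rule summable_comparison_test'[where N = 0, OF _ bound])
  then have summable: "summable (\<lambda>j. norm (\<phi> (k j)))"
    by (rule summable_Suc_iff[THEN iffD1])
  show ?thesis
    by (rule that[of k])
      (use norm_summable_imp_has_sum[OF summable sums] summable in
        \<open>simp_all add: summable_on_UNIV_nonneg_real_iff\<close>)
qed

lemma synth_surj: "\<exists>c\<in>ell1. synth c = x"
proof -
  obtain k :: "nat \<Rightarrow> nat"
    where k: "((\<lambda>j. \<phi> (k j)) has_sum x) UNIV" "(\<lambda>j. norm (\<phi> (k j))) summable_on UNIV"
    using has_sum_subsequence by blast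
  \<comment> \<open>The same index may be chosen repeatedly: \<open>F n\<close> collects its
    occurrences, and \<open>r n\<close>, their total norm, becomes the coefficient of
    \<open>\<psi> n\<close>.\<close>
  define F where "F = (\<lambda>n. {j. k j = n})"
  define r where "r = (\<lambda>n. \<Sum>\<^sub>\<infinity>j\<in>F n. norm (\<phi> (k j)))"
  have fib: "(\<lambda>j. norm (\<phi> (k j))) summable_on F n" for n
    by (rule summable_on_subset_banach[OF k(2)]) simp
  \<comment> \<open>Pairing each \<open>j\<close> with its index \<open>k j\<close> turns the series
    into a double sum over fibres.\<close>
  have inj: "inj_on snd (Sigma UNIV F)" by (auto simp: inj_on_def F_def)
  have im: "snd ` Sigma UNIV F = UNIV" by (auto simp: F_def image_iff)
  have s1: "((\<lambda>p. \<phi> (k (snd p))) has_sum x) (Sigma UNIV F)"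
    using has_sum_reindex[OF inj, of "\<lambda>j. \<phi> (k j)" x] k(1) by (simp add: im o_def)
  have s2: "(\<lambda>p. norm (\<phi> (k (snd p)))) summable_on (Sigma UNIV F)"
    using summable_on_reindex[OF inj, of "\<lambda>j. norm (\<phi> (k j))"] k(2) by (simp add: im o_def)
  have fibre: "((\<lambda>j. \<phi> (k j)) has_sum smul (of_real (r n)) (\<psi> n)) (F n)" for n
  proof -
    have "((\<lambda>j. norm (\<phi> (k j)) *\<^sub>R \<psi> n) has_sum r n *\<^sub>R \<psi> n) (F n)"
      using has_sum_bounded_linear[OF bounded_linear_scaleR_left has_sum_infsum[OF fib]]
      unfolding r_def o_def .
    also have "((\<lambda>j. norm (\<phi> (k j)) *\<^sub>R \<psi> n) has_sum r n *\<^sub>R \<psi> n) (F n) \<longleftrightarrow>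
        ((\<lambda>j. \<phi> (k j)) has_sum r n *\<^sub>R \<psi> n) (F n)"
      by (rule has_sum_cong) (auto simp: F_def scaleR_\<psi>)
    finally show ?thesis by (simp add: smul_of_real)
  qed
  have "((\<lambda>n. smul (of_real (r n)) (\<psi> n)) has_sum x) UNIV"
    by (rule has_sum_SigmaD[OF s1]) (simp add: fibre)
  then have x: "synth (\<lambda>n. of_real (r n)) = x"
    unfolding synth_def by (rule infsumI)
  \<comment> \<open>Absolute convergence along \<open>k\<close> is what puts the coefficients in
    \<open>ell1\<close>.\<close>
  have "r summable_on UNIV"
    using summable_on_Sigma_banach[of "\<lambda>_ j. norm (\<phi> (k j))" UNIV F] s2
    by (simp add: r_def case_prod_unfold)
  moreover have "r n \<ge> 0" for n
    unfolding r_def by (rule infsum_nonneg) simp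
  ultimately have "(\<lambda>n. of_real (r n)) \<in> (ell1 :: (nat \<Rightarrow> 'f) set)"
    by (simp add: ell1_def)
  with x show ?thesis by blast
qed

lemma corr_rank_gram: "corr_rank gram = edim smul UNIV"
proof -
  have "corr_map gram ` ell1 = functional ` synth ` ell1"
    by (simp add: image_image corr_map_gram)
  also have "synth ` ell1 = UNIV" using synth_surj by (metis UNIV_eq_I image_eqI)
  finally show ?thesis
    unfolding corr_rank_def using edim_linear_image[OF linear_functional inj_functional] by simp
qed

end

theorem proposition1:
  fixes smul :: "'f::rc_field \<Rightarrow> 'a::banach \<Rightarrow> 'a"
    and ip :: "'a \<Rightarrow> 'a \<Rightarrow> 'f"
    and \<phi> :: "nat \<Rightarrow> 'a"
    and C :: "nat \<Rightarrow> nat \<Rightarrow> 'f"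
  assumes hilbert: "hilbert_space smul ip"
    and separable: "separable_space (euclidean :: 'a topology)"
    and nonzero: "\<And>n. \<phi> n \<noteq> 0"
    and dense: "closure (range \<phi>) = UNIV"
    and C_def: "\<And>n m. C n m =
      of_real (inverse (norm (\<phi> n))) * of_real (inverse (norm (\<phi> m))) * ip (\<phi> n) (\<phi> m)"
  shows "C extreme_point_of correlation_matrices \<and> corr_rank C = edim smul UNIV"
proof -
  interpret dense_sequence smul ip \<phi>
    using hilbert nonzero dense by (simp add: dense_sequence_def dense_sequence_axioms_def)
  \<comment> \<open>The normalising factors are real and leave either slot of \<open>ip\<close>
    without conjugation.\<close>
  have "C = gram"
    by (simp add: fun_eq_iff C_def gram_def \<psi>_def ip_scaleR_left ip_scaleR_right)
  then show ?thesis using gram_extreme corr_rank_gram by simp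
qed

end
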